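(* Let $n \in \mathbb{N}$ and let $p(z) = \sum_{k=0}^N a_k z^k \in \mathbb{Z}[z]$ be a nonzero polynomial with integer coefficients such that $(1-z)^n$ divides $p(z)$. Then \[ \sum_{k=0}^N |a_k|^2 \ge 2n. \]
   Context: $\mathbb{N}$ denotes the set of positive integers. *)

theory Defs
  imports Complex_Main "HOL-Computational_Algebra.Polynomial"
begin

end

theory Submission
  imports Defs "HOL-Computational_Algebra.Polynomial_FPS"
begin

unbundle fps_syntax

text \<open>
  Since integers satisfy \<open>\<bar>a\<bar>\<^sup>2 \<ge> \<bar>a\<bar>\<close>, it suffices to bound \<open>\<Sum>\<bar>a\<^sub>k\<bar>\<close>. Divisibility by \<open>(1 - z)^n\<close>
  says that the moments \<open>\<Sum> a\<^sub>k k^j\<close> vanish for \<open>j < n\<close>. Splitting \<open>a\<close> into positive and negative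
  parts, the polynomials \<open>A = \<Prod> (1 - k z)^(a\<^sub>k\<^sup>+)\<close> and \<open>B = \<Prod> (1 - k z)^(a\<^sub>k\<^sup>-)\<close> have the
  same degree bound \<open>s = \<Sum> a\<^sub>k\<^sup>+ = \<Sum> a\<^sub>k\<^sup>-\<close>. The power sums occurring in their logarithmic
  derivatives agree up to order \<open>n - 1\<close>, hence \<open>A - B = O(z^n)\<close>. If \<open>s < n\<close>, this forces
  \<open>A = B\<close>; as \<open>A\<close> and \<open>B\<close> have no common root, only \<open>a\<^sub>0\<close> could be nonzero, and the zeroth moment
  excludes that. So \<open>\<Sum>\<bar>a\<^sub>k\<bar> = 2 s \<ge> 2 n\<close>.
\<close>

lemma power_dvd_pderiv:
  fixes p q :: "'a :: idom poly"
  assumes "q ^ Suc m dvd p"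
  shows "q ^ m dvd pderiv p"
proof -
  obtain r where "p = q ^ Suc m * r" using assms by (elim dvdE)
  then have "pderiv p = q ^ Suc m * pderiv r + r * smult (of_nat (Suc m)) (q ^ m * pderiv q)"
    by (simp add: pderiv_mult pderiv_power_Suc del: power_Suc of_nat_Suc)
  also have "\<dots> = q ^ m * (q * pderiv r + smult (of_nat (Suc m)) (r * pderiv q))"
    by (simp add: algebra_simps del: of_nat_Suc)
  finally show ?thesis by simp
qed

text \<open>The operator \<open>z * d/dz\<close> multiplies the \<open>k\<close>-th coefficient by
  \<open>k\<close> and costs at most one factor \<open>1 - z\<close>, so induction on
  \<open>j\<close> reduces to evaluation at \<open>z = 1\<close>.\<close>

lemma moment_eq_0:
  fixes a :: "nat \<Rightarrow> int"
  assumes "[:1, -1:] ^ n dvd (\<Sum>k=0..N. monom (a k) k)" and "j < n"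
  shows "(\<Sum>k=0..N. a k * int k ^ j) = 0"
  using assms
proof (induction j arbitrary: a n)
  case 0
  then have "[:1, -1:] dvd (\<Sum>k=0..N. monom (a k) k)"
    by (meson dvd_power dvd_trans)
  then obtain r where "(\<Sum>k=0..N. monom (a k) k) = [:1, -1:] * r" by (elim dvdE)
  then have "poly (\<Sum>k=0..N. monom (a k) k) 1 = 0" by simp
  then show ?case by (simp add: poly_sum poly_monom)
next
  case (Suc j)
  then obtain m where m: "n = Suc m" by (cases n) auto
  let ?p = "\<Sum>k=0..N. monom (a k) k"
  have "monom 1 1 * pderiv (monom (a k) k) = monom (a k * int k) k" for k
    by (cases k) (simp_all add: pderiv_monom mult_monom mult.commute)
  then have "(\<Sum>k=0..N. monom (a k * int k) k) = monom 1 1 * pderiv ?p"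
    by (simp add: higher_pderiv_sum[of 1, simplified] sum_distrib_left)
  moreover have "[:1, -1:] ^ m dvd pderiv ?p"
    using power_dvd_pderiv Suc.prems(1) m by blast
  ultimately have "[:1, -1:] ^ m dvd (\<Sum>k=0..N. monom (a k * int k) k)" by simp
  from Suc.IH[OF this] show ?case using Suc.prems(2) m by (simp add: mult.assoc)
qed

text \<open>The equation \<open>fps_deriv f = f * l\<close> makes \<open>l\<close> a logarithmic
  derivative without any division.\<close>

lemma fps_deriv_power_logderiv:
  fixes f l :: "'a :: comm_ring_1 fps"
  assumes "fps_deriv f = f * l"
  shows "fps_deriv (f ^ e) = f ^ e * (of_nat e * l)"
  by (induction e) (simp_all add: assms algebra_simps)

lemma fps_deriv_prod_logderiv:
  fixes f l :: "'b \<Rightarrow> 'a :: comm_ring_1 fps"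
  assumes "finite S" and "\<And>k. k \<in> S \<Longrightarrow> fps_deriv (f k) = f k * l k"
  shows "fps_deriv (\<Prod>k\<in>S. f k) = (\<Prod>k\<in>S. f k) * (\<Sum>k\<in>S. l k)"
  using assms by (induction S rule: finite_induct) (simp_all add: algebra_simps)

text \<open>Geometric series for \<open>- c / (1 - c * X)\<close>.\<close>

lemma fps_deriv_one_minus_linear:
  fixes c :: "'a :: comm_ring_1"
  shows "fps_deriv (1 - fps_const c * fps_X) =
    (1 - fps_const c * fps_X) * Abs_fps (\<lambda>j. - (c ^ Suc j))"
proof (rule fps_ext)
  fix m
  show "fps_deriv (1 - fps_const c * fps_X) $ m =
    ((1 - fps_const c * fps_X) * Abs_fps (\<lambda>j. - (c ^ Suc j))) $ m"
    by (cases m) (simp_all add: left_diff_distrib mult.assoc)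
qed

text \<open>Comparing coefficients in \<open>A' = A * L\<close> gives a recursion: coefficient
  \<open>i + 1\<close> of \<open>A\<close> depends only on coefficients up to \<open>i\<close> of
  \<open>A\<close> and \<open>L\<close>. Characteristic 0 allows cancelling the factor
  \<open>i + 1\<close>.\<close>

lemma fps_nth_eq_if_logderiv_eq:
  fixes A B L M :: "'a :: {idom, ring_char_0} fps"
  assumes A: "fps_deriv A = A * L" and B: "fps_deriv B = B * M"
    and "A $ 0 = B $ 0" and LM: "\<And>j. Suc j < n \<Longrightarrow> L $ j = M $ j"
    and "m < n"
  shows "A $ m = B $ m"
  using \<open>m < n\<close>
proof (induction m rule: less_induct)
  case (less m)
  show ?case
  proof (cases m)
    case 0
    then show ?thesis using assms by simp
  next
    case (Suc i)
    have "of_nat (Suc i) * A $ Suc i = (A * L) $ i" unfolding A[symmetric] by simp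
    also have "\<dots> = (B * M) $ i"
      unfolding fps_mult_nth using less Suc LM by (intro sum.cong) auto
    also have "\<dots> = of_nat (Suc i) * B $ Suc i" unfolding B[symmetric] by simp
    finally show ?thesis using Suc by (simp del: of_nat_Suc)
  qed
qed

text \<open>Reciprocal roots \<open>k\<close> instead of roots \<open>k\<close> make the constant
  coefficient 1 and turn power sums into coefficients of the logarithmic derivative.\<close>

definition node_poly :: "nat \<Rightarrow> (nat \<Rightarrow> nat) \<Rightarrow> real poly" where
  "node_poly N e = (\<Prod>k=0..N. [:1, - real k:] ^ e k)"

lemma degree_node_poly_le: "degree (node_poly N e) \<le> (\<Sum>k=0..N. e k)"
proof -
  have "degree (node_poly N e) \<le> (\<Sum>k=0..N. degree ([:1, - real k:] ^ e k))"
    unfolding node_poly_def using degree_prod_sum_le[of "{0..N}"] by (simp add: o_def)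
  also have "\<dots> \<le> (\<Sum>k=0..N. e k)"
  proof (rule sum_mono)
    fix k
    have "degree ([:1, - real k:] ^ e k) \<le> degree [:1, - real k:] * e k"
      by (rule degree_power_le)
    also have "\<dots> \<le> 1 * e k" by (intro mult_right_mono) auto
    finally show "degree ([:1, - real k:] ^ e k) \<le> e k" by simp
  qed
  finally show ?thesis .
qed

lemma poly_node_poly_eq_0_iff:
  assumes "0 < i" and "i \<le> N"
  shows "poly (node_poly N e) (1 / real i) = 0 \<longleftrightarrow> 0 < e i"
  using assms by (auto simp: node_poly_def poly_prod field_simps)

lemma fps_deriv_node_poly:
  "fps_deriv (fps_of_poly (node_poly N e)) = fps_of_poly (node_poly N e) *
    (\<Sum>k=0..N. of_nat (e k) * Abs_fps (\<lambda>j. - (real k ^ Suc j)))"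
proof -
  have "fps_of_poly [:1, - real k:] = 1 - fps_const (real k) * fps_X" for k
    by (rule fps_ext) (simp add: coeff_pCons split: nat.splits)
  then show ?thesis
    unfolding node_poly_def fps_of_poly_prod fps_of_poly_power
    by (intro fps_deriv_prod_logderiv fps_deriv_power_logderiv)
       (simp_all only: finite_atLeastAtMost fps_deriv_one_minus_linear)
qed

lemma node_poly_eq_if_power_sums_eq:
  assumes sums: "\<And>j. j < n \<Longrightarrow> (\<Sum>k=0..N. real (e k) * real k ^ j) = (\<Sum>k=0..N. real (f k) * real k ^ j)"
    and "(\<Sum>k=0..N. e k) < n" and "(\<Sum>k=0..N. f k) < n"
  shows "node_poly N e = node_poly N f"
proof (rule poly_eqI)
  fix m
  have of_nat_nth: "(of_nat c * h) $ j = real c * h $ j" for c j and h :: "real fps"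
    by (metis fps_mult_left_const_nth fps_of_nat)
  have L: "(\<Sum>k=0..N. of_nat (g k) * Abs_fps (\<lambda>j. - (real k ^ Suc j))) $ j
      = - (\<Sum>k=0..N. real (g k) * real k ^ Suc j)" for g :: "nat \<Rightarrow> nat" and j
    by (simp add: fps_sum_nth sum_negf of_nat_nth)
  have zero: "fps_of_poly (node_poly N g) $ 0 = 1" for g
    by (simp add: node_poly_def flip: poly_0_coeff_0) (simp add: poly_prod)
  show "coeff (node_poly N e) m = coeff (node_poly N f) m"
  proof (cases "m < n")
    case True
    have "fps_of_poly (node_poly N e) $ m = fps_of_poly (node_poly N f) $ m"
      \<comment> \<open>Coefficient \<open>j\<close> of the logarithmic derivative is minus the
        power sum of exponent \<open>Suc j\<close>, hence agreement is available exactly when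
        \<open>Suc j < n\<close>.\<close>
      by (rule fps_nth_eq_if_logderiv_eq[OF fps_deriv_node_poly fps_deriv_node_poly _ _ True])
         (simp_all only: L zero sums)
    then show ?thesis by simp
  next
    case False
    then show ?thesis
      using assms(2,3) degree_node_poly_le[of N e] degree_node_poly_le[of N f]
      by (simp add: coeff_eq_0)
  qed
qed

theorem theorem3p2:
  fixes n N :: nat and a :: "nat \<Rightarrow> int" and p :: "int poly"
  assumes "n \<ge> 1"
    and "p = (\<Sum>k=0..N. monom (a k) k)"
    and "p \<noteq> 0"
    and "[:1, -1:] ^ n dvd p"
  shows "(\<Sum>k=0..N. \<bar>a k\<bar>\<^sup>2) \<ge> 2 * int n"
proof -
  define e where "e k = nat (a k)" for k
  define f where "f k = nat (- a k)" for k
  have a_eq: "a k = int (e k) - int (f k)" for k by (simp add: e_def f_def)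
  have moment: "(\<Sum>k=0..N. a k * int k ^ j) = 0" if "j < n" for j
    using moment_eq_0 assms that by blast
  have sums: "(\<Sum>k=0..N. int (e k) * int k ^ j) = (\<Sum>k=0..N. int (f k) * int k ^ j)"
    if "j < n" for j
    using moment[OF that] by (simp add: a_eq left_diff_distrib sum_subtractf)
  have real_sums: "(\<Sum>k=0..N. real (e k) * real k ^ j) = (\<Sum>k=0..N. real (f k) * real k ^ j)"
    if "j < n" for j
    using arg_cong[OF sums[OF that], of real_of_int] by simp
  have s: "(\<Sum>k=0..N. e k) = (\<Sum>k=0..N. f k)"
    using sums[of 0] assms(1) by (simp flip: of_nat_sum)
  have "n \<le> (\<Sum>k=0..N. e k)"
  proof (rule ccontr)
    assume "\<not> n \<le> (\<Sum>k=0..N. e k)"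
    then have eq: "node_poly N e = node_poly N f"
      using real_sums s by (intro node_poly_eq_if_power_sums_eq[of n]) auto
    \<comment> \<open>At most one of \<open>e k\<close> and \<open>f k\<close> is positive, but
      \<open>1 / k\<close> is a root of both polynomials or of neither.\<close>
    have "a k = 0" if "0 < k" "k \<le> N" for k
      using poly_node_poly_eq_0_iff[OF that, of e] poly_node_poly_eq_0_iff[OF that, of f] eq
      by (auto simp: e_def f_def)
    \<comment> \<open>The factor for \<open>k = 0\<close> is the constant 1, so
      \<open>node_poly\<close> cannot detect \<open>a 0\<close>.\<close>
    moreover from this have "a 0 = 0"
      using moment[of 0] assms(1) by (simp add: sum.atLeast_Suc_atMost)
    ultimately have "a k = 0" if "k \<le> N" for k using that by (cases "k = 0") auto
    then show False using assms(2,3) by simp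
  qed
  then have "2 * int n \<le> (\<Sum>k=0..N. int (e k)) + (\<Sum>k=0..N. int (f k))"
    using s by (simp flip: of_nat_sum)
  also have "\<dots> = (\<Sum>k=0..N. \<bar>a k\<bar>)"
    by (simp add: e_def f_def flip: sum.distrib) (intro sum.cong, auto)
  also have "\<dots> \<le> (\<Sum>k=0..N. \<bar>a k\<bar>\<^sup>2)"
  proof (rule sum_mono)
    fix k
    show "\<bar>a k\<bar> \<le> \<bar>a k\<bar>\<^sup>2"
      using self_le_power[of "\<bar>a k\<bar>" 2] by (cases "a k = 0") auto
  qed
  finally show ?thesis .
qed

end
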